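(* Let $\mathcal X'\subset\mathcal X$ be a finite set of outcomes and let $q$ be a real rational function in the variables $(w_x)_{x\in\mathcal X'}$, evaluated at the social cost function (SCF) values $w_x=C(\mathbf J(x))$, $x\in\mathcal X'$, where $\mathbf J$ is a profile of cost functions. (i) Under Cardinal Unit Comparability (CUC) or under Cardinal Full Comparability (CFC), with $C$ an admissible SCF for that comparability level, the rational function $q$ of the evaluations $\{C(\mathbf J(x))\}_{x\in\mathcal X'}$ is invariant under the corresponding transformations of $\mathbf J$ if and only if it is a function of the ratios of differences $$\frac{C(\mathbf J(x))-C(\mathbf J(z))}{C(\mathbf J(y))-C(\mathbf J(w))},\qquad x,y,z,w\in\mathcal X'.$$ (ii) Under Cardinal Non-Comparability (CNC), with reference point $x_0$ and $C$ an admissible SCF for CNC, with values denoted $C(\mathbf J(x),\mathbf J(x_0))$, the rational function $q$ of the evaluations $\{C(\mathbf J(x),\mathbf J(x_0))\}_{x\in\mathcal X'}$ is invariant under the corresponding transformations of $\mathbf J$ if and only if it is a function of the ratios $$\frac{C(\mathbf J(x),\mathbf J(x_0))}{C(\mathbf J(y),\mathbf J(x_0))},\qquad x,y\in\mathcal X'.$$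
   Context: $\mathcal N=\{1,\dots,n\}$ is a finite set of agents and $\mathcal X$ is the set of outcomes. A profile is $\mathbf J=(J_1,\dots,J_n)$ with each $J_i:\mathcal X\to\mathbb R$ an arbitrary real-valued (cost) function; $\mathbf J(x)=(J_1(x),\dots,J_n(x))$. Transformations corresponding to each comparability level (replacing $J_i$ by $J_i'$ for all $i$): - CUC: $J_i'(x)=a\,J_i(x)+b_i$, with common $a>0$ and individual $b_i\in\mathbb R$. - CFC: $J_i'(x)=a\,J_i(x)+b$, with common $a>0$ and common $b\in\mathbb R$. - CNC: $J_i'(x)=a_i\,J_i(x)+b_i$, with individual $a_i>0$ and $b_i\in\mathbb R$. Admissible SCFs for each level: - CUC: $C(\mathbf J(x))=\sum_{i\in\mathcal N}c_iJ_i(x)$, for fixed $c_i>0$. - CFC: $C(\mathbf J(x))=m(x)+g\big(J_1(x)-m(x),\dots,J_n(x)-m(x)\big)$, where $m(x)=\frac1n\sum_{i\in\mathcal N}J_i(x)$ and $g:\mathbb R^n\to\mathbb R$ is a fixed function homogeneous of degree 1, i.e. $g(\lambda v)=\lambda g(v)$ for all $\lambda>0$ and $v\in\mathbb R^n$. - CNC: $C(\mathbf J(x),\mathbf J(x_0))=-\prod_{i\in\mathcal N}[J_i(x_0)-J_i(x)]^{c_i}$, for fixed $c_i>0$, where $x_0\in\mathcal X$ is a fixed benchmark (reference) outcome and the profiles considered satisfy $J_i(x_0)\ge J_i(x)$ for all $i\in\mathcal N$ and $x\in\mathcal X$. Conventions. "$q$ is invariant under the corresponding transformations" means: for every profile $\mathbf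 J$ (satisfying the benchmark condition in the CNC case) and every transformation of the given level, the value of $q$ at the SCF evaluations of $\mathbf J$ equals its value at the SCF evaluations of the transformed profile $\mathbf J'$, whenever both are defined. "$q$ is a function of the ratios" means: there is a function $F$ such that, for every such profile $\mathbf J$ for which $q$ is defined and all denominators of the listed ratios are nonzero, the value of $q$ at the SCF evaluations of $\mathbf J$ equals $F$ applied to the collection of those ratios; ratios whose denominator is identically zero for all profiles (e.g. $y=w$ in (i), $y=x_0$ in (ii)) are excluded from the list. *)

theory Defs
  imports "HOL-Analysis.Analysis" "HOL-Library.Poly_Mapping" "HOL-Library.FuncSet"
begin

section \<open>Real rational functions in a set of variables\<close>

text \<open>
  A polynomial is a finitely supported map from monomials to coefficients, a monomial a finitely
  supported map from variables to exponents; the ring structure (convolution product) is the one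
  of \<^theory>\<open>HOL-Library.Poly_Mapping\<close>.
\<close>

type_synonym 'x mpoly = "('x \<Rightarrow>\<^sub>0 nat) \<Rightarrow>\<^sub>0 real"

definition polys_in :: "'x set \<Rightarrow> 'x mpoly set" where
  "polys_in X = {P. \<forall>m \<in> Poly_Mapping.keys P. Poly_Mapping.keys m \<subseteq> X}"

definition mpoly_eval :: "'x mpoly \<Rightarrow> ('x \<Rightarrow> real) \<Rightarrow> real" where
  "mpoly_eval P w =
     (\<Sum>m \<in> Poly_Mapping.keys P. Poly_Mapping.lookup P m *
        (\<Prod>x \<in> Poly_Mapping.keys m. w x ^ Poly_Mapping.lookup m x))"

text \<open>
  The field of fractions of the polynomial ring in the variables X. It is built by hand because
  the library type of fractions needs an instance of \<^class>\<open>idom\<close>, which polynomials only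
  have when the type of variables is linearly ordered.
\<close>

type_synonym 'x ratfun = "('x mpoly \<times> 'x mpoly) set"

definition fractions :: "'x set \<Rightarrow> ('x mpoly \<times> 'x mpoly) set" where
  "fractions X = polys_in X \<times> (polys_in X - {0})"

definition fraction_rel :: "'x set \<Rightarrow> (('x mpoly \<times> 'x mpoly) \<times> ('x mpoly \<times> 'x mpoly)) set" where
  "fraction_rel X =
     {((P, Q), (P', Q')). (P, Q) \<in> fractions X \<and> (P', Q') \<in> fractions X \<and> P * Q' = P' * Q}"

definition rational_functions :: "'x set \<Rightarrow> 'x ratfun set" where
  "rational_functions X = fractions X // fraction_rel X"

text \<open>
  A rational function is defined at a point if one of its representing fractions has a
  denominator that does not vanish there; the value does not depend on which one is taken.
\<close>

definition rat_defined :: "'x ratfun \<Rightarrow> ('x \<Rightarrow> real) \<Rightarrow> bool" where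
  "rat_defined q w \<longleftrightarrow> (\<exists>(P, Q) \<in> q. mpoly_eval Q w \<noteq> 0)"

definition rat_eval :: "'x ratfun \<Rightarrow> ('x \<Rightarrow> real) \<Rightarrow> real" where
  "rat_eval q w =
     (THE v. \<exists>(P, Q) \<in> q. mpoly_eval Q w \<noteq> 0 \<and> v = mpoly_eval P w / mpoly_eval Q w)"


section \<open>Profiles, comparability levels and social cost functions\<close>

text \<open>The agents are the elements of the (nonempty) finite type 'n, the outcomes those of 'x.\<close>

type_synonym ('n, 'x) profile = "'n \<Rightarrow> 'x \<Rightarrow> real"

definition costs_at :: "('n::finite, 'x) profile \<Rightarrow> 'x \<Rightarrow> real ^ 'n" where
  "costs_at J x = (\<chi> i. J i x)"

definition CUC_transform :: "('n, 'x) profile \<Rightarrow> ('n, 'x) profile \<Rightarrow> bool" where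
  "CUC_transform J J' \<longleftrightarrow> (\<exists>a>0. \<exists>b. \<forall>i x. J' i x = a * J i x + b i)"

definition CFC_transform :: "('n, 'x) profile \<Rightarrow> ('n, 'x) profile \<Rightarrow> bool" where
  "CFC_transform J J' \<longleftrightarrow> (\<exists>a>0. \<exists>b. \<forall>i x. J' i x = a * J i x + b)"

definition CNC_transform :: "('n, 'x) profile \<Rightarrow> ('n, 'x) profile \<Rightarrow> bool" where
  "CNC_transform J J' \<longleftrightarrow> (\<exists>a b. (\<forall>i. a i > 0) \<and> (\<forall>i x. J' i x = a i * J i x + b i))"

definition CUC_admissible :: "(real ^ 'n \<Rightarrow> real) \<Rightarrow> bool" where
  "CUC_admissible C \<longleftrightarrow>
     (\<exists>c. (\<forall>i. c i > 0) \<and> (\<forall>v. C v = (\<Sum>i\<in>UNIV. c i * v $ i)))"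

definition mean_cost :: "real ^ 'n \<Rightarrow> real" where
  "mean_cost v = (1 / real CARD('n)) * (\<Sum>i\<in>UNIV. v $ i)"

definition CFC_admissible :: "(real ^ 'n \<Rightarrow> real) \<Rightarrow> bool" where
  "CFC_admissible C \<longleftrightarrow>
     (\<exists>g :: real ^ 'n \<Rightarrow> real.
        (\<forall>t>0. \<forall>v. g (t *\<^sub>R v) = t * g v) \<and>
        (\<forall>v. C v = mean_cost v + g (\<chi> i. v $ i - mean_cost v)))"

text \<open>
  The second argument is the cost vector of the reference outcome. The formula is only imposed
  where the bases of the powers are nonnegative; there, for positive exponents, \<open>powr\<close> is
  the usual power, including the value 0 at base 0.
\<close>

definition CNC_admissible :: "(real ^ 'n \<Rightarrow> real ^ 'n \<Rightarrow> real) \<Rightarrow> bool" where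
  "CNC_admissible C \<longleftrightarrow>
     (\<exists>c. (\<forall>i. c i > 0) \<and>
        (\<forall>v v0. (\<forall>i. v0 $ i \<ge> v $ i) \<longrightarrow>
           C v v0 = - (\<Prod>i\<in>UNIV. (v0 $ i - v $ i) powr c i)))"

definition benchmark_profile :: "'x \<Rightarrow> ('n, 'x) profile \<Rightarrow> bool" where
  "benchmark_profile x0 J \<longleftrightarrow> (\<forall>i x. J i x0 \<ge> J i x)"


section \<open>Invariance and functions of ratios\<close>

text \<open>
  In both definitions, \<open>D\<close> is the condition on the profiles considered and \<open>V J x\<close> is the value
  of the social cost function at the outcome \<open>x\<close> for the profile \<open>J\<close>.
\<close>

definition invariant_under ::
  "('p \<Rightarrow> bool) \<Rightarrow> ('p \<Rightarrow> 'p \<Rightarrow> bool) \<Rightarrow> ('p \<Rightarrow> 'x \<Rightarrow> real) \<Rightarrow> 'x ratfun \<Rightarrow> bool" where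
  "invariant_under D T V q \<longleftrightarrow>
     (\<forall>J J'. D J \<longrightarrow> T J J' \<longrightarrow> rat_defined q (V J) \<longrightarrow> rat_defined q (V J') \<longrightarrow>
        rat_eval q (V J) = rat_eval q (V J'))"

text \<open>
  The ratios are indexed by \<open>K\<close>, the \<open>k\<close>-th one having numerator \<open>num w k\<close> and denominator
  \<open>den w k\<close> at the values \<open>w\<close>; those whose denominator vanishes for all profiles are dropped.
  The function \<open>F\<close> receives the family of the listed ratios and nothing else.
\<close>

definition listed_ratios ::
  "('p \<Rightarrow> bool) \<Rightarrow> ('p \<Rightarrow> 'x \<Rightarrow> real) \<Rightarrow> 'k set \<Rightarrow> (('x \<Rightarrow> real) \<Rightarrow> 'k \<Rightarrow> real) \<Rightarrow> 'k set" where
  "listed_ratios D V K den = {k \<in> K. \<exists>J. D J \<and> den (V J) k \<noteq> 0}"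

definition function_of_ratios ::
  "('p \<Rightarrow> bool) \<Rightarrow> ('p \<Rightarrow> 'x \<Rightarrow> real) \<Rightarrow> 'k set \<Rightarrow> (('x \<Rightarrow> real) \<Rightarrow> 'k \<Rightarrow> real) \<Rightarrow>
   (('x \<Rightarrow> real) \<Rightarrow> 'k \<Rightarrow> real) \<Rightarrow> 'x ratfun \<Rightarrow> bool" where
  "function_of_ratios D V K num den q \<longleftrightarrow>
     (\<exists>F :: ('k \<Rightarrow> real) \<Rightarrow> real. \<forall>J.
        D J \<longrightarrow> rat_defined q (V J) \<longrightarrow> (\<forall>k \<in> listed_ratios D V K den. den (V J) k \<noteq> 0) \<longrightarrow>
        rat_eval q (V J) = F (\<lambda>k \<in> listed_ratios D V K den. num (V J) k / den (V J) k))"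

definition function_of_difference_ratios ::
  "'x set \<Rightarrow> ('p \<Rightarrow> bool) \<Rightarrow> ('p \<Rightarrow> 'x \<Rightarrow> real) \<Rightarrow> 'x ratfun \<Rightarrow> bool" where
  "function_of_difference_ratios X D V q \<longleftrightarrow>
     function_of_ratios D V (X \<times> X \<times> X \<times> X)
       (\<lambda>w (x, y, z, u). w x - w z) (\<lambda>w (x, y, z, u). w y - w u) q"

definition function_of_value_ratios ::
  "'x set \<Rightarrow> ('p \<Rightarrow> bool) \<Rightarrow> ('p \<Rightarrow> 'x \<Rightarrow> real) \<Rightarrow> 'x ratfun \<Rightarrow> bool" where
  "function_of_value_ratios X D V q \<longleftrightarrow>
     function_of_ratios D V (X \<times> X) (\<lambda>w (x, y). w x) (\<lambda>w (x, y). w y) q"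

end

theory Submission
  imports Defs "HOL-Computational_Algebra.Polynomial"
begin

text \<open>
  The transformations of a profile act on the values \<open>w\<close> of the social cost function in a very simple
  way. Under CUC and CFC they induce exactly the maps \<open>w \<mapsto> a w + b\<close> with \<open>a > 0\<close>, and every
  family \<open>w\<close> of real values occurs. Under CNC they induce exactly the maps \<open>w \<mapsto> s w\<close> with \<open>s > 0\<close>,
  and the families that occur are those with \<open>w \<le> 0\<close> that vanish at the reference outcome. All that
  remains is a statement about rational functions of \<open>w\<close>.

  Suppose that all denominators are nonzero. Then two families with the same ratios of differences
  satisfy \<open>w' = a w + b\<close>, and two nonpositive families with the same ratios of values satisfy \<open>w' = s w\<close>
  with \<open>s > 0\<close>. So for generic values, equal ratios mean equivalence under the group, up to the sign of
  \<open>a\<close>. Two gaps are left, and both are closed because a rational identity that holds at infinitely many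
  parameters of a polynomial curve holds at every parameter where both sides are defined
  (\<open>rat_identity_principle\<close>).

  \<^item> Ratios of differences do not see the sign of \<open>a\<close>, but invariance is only assumed for \<open>a > 0\<close>. The
    identity \<open>q (a w + b) = q w\<close> is rational in \<open>a\<close>, hence extends from positive to negative \<open>a\<close>.
  \<^item> A function of the ratios says nothing about families at which a denominator vanishes, but
    invariance is demanded there as well. Such a family is perturbed to \<open>w + t d\<close>, which is generic
    for infinitely many \<open>t\<close>, and the identity extends to \<open>t = 0\<close>.

  For these arguments the value of a rational function must not depend on the fraction that
  represents it. Two fractions are both equal to a third one with denominator \<open>Q0 \<noteq> 0\<close>, which may
  vanish at the point in question; since a nonzero real polynomial has a nonzero value somewhere, the
  point can be joined to one where \<open>Q0\<close> does not vanish, and \<open>Q0\<close> can be cancelled along that line.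
\<close>

section \<open>Evaluation of polynomials\<close>

lemma mpoly_eval_superset:
  assumes "finite M" "Poly_Mapping.keys P \<subseteq> M"
  shows "mpoly_eval P w = (\<Sum>m\<in>M. Poly_Mapping.lookup P m *
           (\<Prod>x\<in>Poly_Mapping.keys m. w x ^ Poly_Mapping.lookup m x))"
  unfolding mpoly_eval_def
  by (rule sum.mono_neutral_left) (use assms in \<open>auto simp: in_keys_iff\<close>)

lemma mpoly_eval_single:
  "mpoly_eval (Poly_Mapping.single m c) w =
     c * (\<Prod>x\<in>Poly_Mapping.keys m. w x ^ Poly_Mapping.lookup m x)"
  by (cases "c = 0") (simp_all add: mpoly_eval_def)

lemma mpoly_eval_add: "mpoly_eval (P + Q) w = mpoly_eval P w + mpoly_eval Q w"
proof -
  let ?M = "Poly_Mapping.keys P \<union> Poly_Mapping.keys Q"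
  show ?thesis
    using mpoly_eval_superset[of ?M P w] mpoly_eval_superset[of ?M Q w]
      mpoly_eval_superset[of ?M "P + Q" w] Poly_Mapping.keys_add[of P Q]
    by (simp add: lookup_add algebra_simps sum.distrib)
qed

lemma monomial_eval_superset:
  fixes w :: "'x \<Rightarrow> 'a::comm_semiring_1"
  assumes "finite Y" "Poly_Mapping.keys m \<subseteq> Y"
  shows "(\<Prod>x\<in>Poly_Mapping.keys m. w x ^ Poly_Mapping.lookup m x) =
         (\<Prod>x\<in>Y. w x ^ Poly_Mapping.lookup m x)"
  by (rule prod.mono_neutral_left) (use assms in \<open>auto simp: in_keys_iff\<close>)

lemma monomial_eval_add:
  fixes w :: "'x \<Rightarrow> 'a::comm_semiring_1"
  shows "(\<Prod>x\<in>Poly_Mapping.keys (m + m'). w x ^ Poly_Mapping.lookup (m + m') x) =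
     (\<Prod>x\<in>Poly_Mapping.keys m. w x ^ Poly_Mapping.lookup m x) *
     (\<Prod>x\<in>Poly_Mapping.keys m'. w x ^ Poly_Mapping.lookup m' x)"
proof -
  let ?Y = "Poly_Mapping.keys m \<union> Poly_Mapping.keys m'"
  show ?thesis
    using monomial_eval_superset[of ?Y m w] monomial_eval_superset[of ?Y m' w]
      monomial_eval_superset[of ?Y "m + m'" w] Poly_Mapping.keys_add[of m m']
    by (simp add: lookup_add power_add prod.distrib)
qed

lemma mpoly_induct [case_names single add]:
  fixes P :: "'x mpoly"
  assumes "\<And>m c. R (Poly_Mapping.single m c)" "\<And>P Q. R P \<Longrightarrow> R Q \<Longrightarrow> R (P + Q)"
  shows "R P"
proof (induction P rule: update_induct)
  case const then show ?case using assms(1)[of _ 0] by simp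
next
  case (update f a b)
  have "Poly_Mapping.update a b f = f + Poly_Mapping.single a b"
    using update by (auto intro!: poly_mapping_eqI simp: lookup_update lookup_add lookup_single in_keys_iff when_def)
  then show ?case using assms update by metis
qed

lemma mpoly_eval_mult: "mpoly_eval (P * Q) w = mpoly_eval P w * mpoly_eval Q w"
proof (induction P rule: mpoly_induct)
  case (single m c)
  show ?case
    by (induction Q rule: mpoly_induct)
       (simp_all add: mult_single mpoly_eval_single monomial_eval_add mpoly_eval_add algebra_simps)
qed (simp add: mpoly_eval_add algebra_simps)

text \<open>
  Restriction to a curve reduces questions about polynomials in many variables to univariate ones, where cancellation and
  finiteness of the zero set are available.
\<close>

definition along_curve :: "('x \<Rightarrow> real poly) \<Rightarrow> 'x mpoly \<Rightarrow> real poly" where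
  "along_curve h P = (\<Sum>m\<in>Poly_Mapping.keys P. [:Poly_Mapping.lookup P m:] *
     (\<Prod>x\<in>Poly_Mapping.keys m. h x ^ Poly_Mapping.lookup m x))"

lemma poly_along_curve: "poly (along_curve h P) t = mpoly_eval P (\<lambda>x. poly (h x) t)"
  by (simp add: along_curve_def mpoly_eval_def poly_sum poly_prod)

lemma mpoly_eval_cong:
  assumes "P \<in> polys_in X" "\<And>x. x \<in> X \<Longrightarrow> w x = w' x"
  shows "mpoly_eval P w = mpoly_eval P w'"
  using assms unfolding mpoly_eval_def polys_in_def
  by (intro sum.cong prod.cong arg_cong2[where f = "(*)"] refl) (auto simp: subset_iff)

text \<open>
  By induction on the variables: in a new variable, the sum is a univariate polynomial that vanishes
  identically, so each of its coefficients vanishes, and these are sums over the exponent vectors with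
  a fixed exponent of the new variable. Only the exponents of variables in \<open>X\<close> matter, so the
  exponent vectors in \<open>M\<close> need to be distinct on \<open>X\<close>.
\<close>

lemma monomials_linearly_independent:
  fixes f :: "('x \<Rightarrow> nat) \<Rightarrow> real"
  assumes "finite X" "finite M" "inj_on (\<lambda>m. restrict m X) M"
    and "\<And>w. (\<Sum>m\<in>M. f m * (\<Prod>x\<in>X. w x ^ m x)) = 0"
    and "m \<in> M"
  shows "f m = 0"
  using assms
proof (induction X arbitrary: M m rule: finite_induct)
  case empty
  have "M = {m}" using empty.prems by (auto simp: inj_on_def)
  then show ?case using empty.prems(3)[of undefined] by simp
next
  case (insert x X)
  define k where "k = m x"
  define M' where "M' = {m' \<in> M. m' x = k}"
  have "(\<Sum>m'\<in>M'. f m' * (\<Prod>y\<in>X. w y ^ m' y)) = 0" for w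
  proof -
    \<comment> \<open>The sum as a polynomial in the variable x alone, the others having the values \<open>w\<close>.\<close>
    define p where "p = (\<Sum>m'\<in>M. monom (f m' * (\<Prod>y\<in>X. w y ^ m' y)) (m' x))"
    have "poly p t = 0" for t
    proof -
      have "(\<Prod>y\<in>X. (w(x := t)) y ^ m' y) = (\<Prod>y\<in>X. w y ^ m' y)" for m'
        using insert.hyps by (intro prod.cong) auto
      then show ?thesis
        using insert.prems(3)[of "w(x := t)"] insert.hyps
        by (simp add: p_def poly_sum poly_monom algebra_simps)
    qed
    then have "p = 0" using poly_all_0_iff_0 by blast
    then have "0 = coeff p k" by simp
    also have "\<dots> = (\<Sum>m'\<in>M. if m' x = k then f m' * (\<Prod>y\<in>X. w y ^ m' y) else 0)"
      by (simp add: p_def coeff_sum)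
    also have "\<dots> = (\<Sum>m'\<in>M'. f m' * (\<Prod>y\<in>X. w y ^ m' y))"
      unfolding M'_def using insert.prems(1) by (simp add: sum.inter_filter)
    finally show ?thesis by simp
  qed
  moreover have "inj_on (\<lambda>m. restrict m X) M'"
  proof (rule inj_onI)
    fix m1 m2 assume *: "m1 \<in> M'" "m2 \<in> M'" "restrict m1 X = restrict m2 X"
    then have "restrict m1 (insert x X) = restrict m2 (insert x X)"
      by (auto simp: M'_def restrict_def fun_eq_iff split: if_splits; metis)
    then show "m1 = m2" using inj_onD[OF insert.prems(2), of m1 m2] * by (simp add: M'_def)
  qed
  moreover have "finite M'" "m \<in> M'" using insert.prems by (simp_all add: M'_def k_def)
  ultimately show ?case using insert.IH by blast
qed

lemma mpoly_nonzero_value: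
  assumes "P \<noteq> 0"
  shows "\<exists>w. mpoly_eval P w \<noteq> 0"
proof (rule ccontr)
  assume "\<nexists>w. mpoly_eval P w \<noteq> 0"
  then have zero: "mpoly_eval P w = 0" for w by blast
  define X where "X = (\<Union>m\<in>Poly_Mapping.keys P. Poly_Mapping.keys m)"
  define M where "M = Poly_Mapping.lookup ` Poly_Mapping.keys P"
  have inj: "inj_on Poly_Mapping.lookup A" for A :: "('a \<Rightarrow>\<^sub>0 nat) set"
    by (simp add: inj_on_def lookup_inject)
  \<comment> \<open>The coefficients, indexed by plain functions instead of finitely supported maps.\<close>
  define f where "f e = Poly_Mapping.lookup P (Abs_poly_mapping e)" for e
  have "(\<Sum>e\<in>M. f e * (\<Prod>x\<in>X. w x ^ e x)) = mpoly_eval P w" for w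
    unfolding M_def mpoly_eval_def
    by (subst sum.reindex[OF inj]) (auto simp: X_def f_def intro!: sum.cong monomial_eval_superset[symmetric])
  moreover have "inj_on (\<lambda>m. restrict m X) M"
  proof (rule inj_onI)
    fix m1 m2 assume *: "m1 \<in> M" "m2 \<in> M" "restrict m1 X = restrict m2 X"
    have "m1 x = m2 x" for x
    proof (cases "x \<in> X")
      case True then show ?thesis using * by (metis restrict_apply)
    next
      case False then show ?thesis using * by (force simp: M_def X_def in_keys_iff)
    qed
    then show "m1 = m2" by blast
  qed
  moreover have "finite X" "finite M" by (auto simp: X_def M_def)
  moreover obtain m where m: "m \<in> Poly_Mapping.keys P" using assms by fastforce
  ultimately have "f (Poly_Mapping.lookup m) = 0"
    using zero by (intro monomials_linearly_independent[where f = f and X = X and M = M])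
      (simp_all add: M_def)
  then show False using m by (simp add: f_def in_keys_iff)
qed

section \<open>Values of rational functions\<close>

text \<open>
  Only the proportionality to one fixed fraction with nonzero denominator is kept. Proportionality of any
  two representatives to each other is not immediate, because it takes cancellation of \<open>Q0\<close>.
\<close>

lemma rational_function_rep:
  assumes "q \<in> rational_functions X"
  shows "\<exists>P0 Q0. Q0 \<noteq> 0 \<and> (\<forall>(P, Q) \<in> q. P0 * Q = P * Q0)"
proof -
  obtain P0 Q0 where "(P0, Q0) \<in> fractions X" "q = fraction_rel X `` {(P0, Q0)}"
    using assms unfolding rational_functions_def by (auto elim!: quotientE)
  then have "Q0 \<noteq> 0 \<and> (\<forall>(P, Q) \<in> q. P0 * Q = P * Q0)"
    by (auto simp: fraction_rel_def fractions_def)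
  then show ?thesis by blast
qed

lemma rational_function_polys_in:
  assumes "q \<in> rational_functions X" "(P, Q) \<in> q"
  shows "P \<in> polys_in X" "Q \<in> polys_in X"
  using assms by (auto simp: rational_functions_def fraction_rel_def fractions_def elim!: quotientE)

text \<open>
  The value does not depend on the representative: \<open>(P Q' - P' Q) Q0\<close> vanishes everywhere, and
  restricted to the line from \<open>w\<close> to a point where \<open>Q0\<close> does not vanish, the factor \<open>Q0\<close> is a nonzero
  univariate polynomial and can be cancelled.
\<close>

lemma rat_eval_eq:
  assumes q: "q \<in> rational_functions X" and PQ: "(P, Q) \<in> q" "mpoly_eval Q w \<noteq> 0"
  shows "rat_eval q w = mpoly_eval P w / mpoly_eval Q w"
proof -
  obtain P0 Q0 where Q0: "Q0 \<noteq> 0" and rep: "\<And>P Q. (P, Q) \<in> q \<Longrightarrow> P0 * Q = P * Q0"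
    using rational_function_rep[OF q] by fast
  obtain v where v: "mpoly_eval Q0 v \<noteq> 0" using mpoly_nonzero_value[OF Q0] by blast
  have cross: "mpoly_eval P w * mpoly_eval Q' w = mpoly_eval P' w * mpoly_eval Q w"
    if P'Q': "(P', Q') \<in> q" for P' Q'
  proof -
    define h where "h x = [:w x, v x - w x:]" for x
    let ?c = "along_curve h"
    have h: "(\<lambda>x. poly (h x) 0) = w" "(\<lambda>x. poly (h x) 1) = v" by (simp_all add: h_def)
    have "poly ((?c P * ?c Q' - ?c P' * ?c Q) * ?c Q0) t = 0" for t
    proof -
      let ?e = "\<lambda>R. mpoly_eval R (\<lambda>x. poly (h x) t)"
      have PQ0: "?e P0 * ?e Q = ?e P * ?e Q0" using rep[OF PQ(1)] by (metis mpoly_eval_mult)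
      have P'Q0: "?e P0 * ?e Q' = ?e P' * ?e Q0" using rep[OF P'Q'] by (metis mpoly_eval_mult)
      have "?e P * ?e Q' * ?e Q0 = (?e P * ?e Q0) * ?e Q'" by (simp only: ac_simps)
      also have "\<dots> = (?e P0 * ?e Q') * ?e Q" by (simp only: PQ0[symmetric] ac_simps)
      also have "\<dots> = ?e P' * ?e Q * ?e Q0" by (simp only: P'Q0 ac_simps)
      finally show ?thesis by (simp add: poly_along_curve left_diff_distrib)
    qed
    then have "(?c P * ?c Q' - ?c P' * ?c Q) * ?c Q0 = 0" using poly_all_0_iff_0 by blast
    moreover have "poly (?c Q0) 1 \<noteq> 0" using v by (simp add: poly_along_curve h)
    then have "?c Q0 \<noteq> 0" by fastforce
    ultimately have "?c P * ?c Q' = ?c P' * ?c Q" by simp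
    then have "poly (?c P * ?c Q') 0 = poly (?c P' * ?c Q) 0" by simp
    then show ?thesis by (simp add: poly_along_curve h)
  qed
  show ?thesis
    unfolding rat_eval_def
  proof (rule the_equality)
    show "\<exists>(P', Q')\<in>q. mpoly_eval Q' w \<noteq> 0 \<and>
        mpoly_eval P w / mpoly_eval Q w = mpoly_eval P' w / mpoly_eval Q' w"
      using PQ by blast
  next
    fix r assume "\<exists>(P', Q')\<in>q. mpoly_eval Q' w \<noteq> 0 \<and> r = mpoly_eval P' w / mpoly_eval Q' w"
    then obtain P' Q' where "(P', Q') \<in> q" "mpoly_eval Q' w \<noteq> 0"
      and r: "r = mpoly_eval P' w / mpoly_eval Q' w" by blast
    then show "r = mpoly_eval P w / mpoly_eval Q w"
      using cross[of P' Q'] PQ(2) unfolding r by (subst frac_eq_eq) simp_all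
  qed
qed

lemma rat_cong:
  assumes q: "q \<in> rational_functions X" and eq: "\<And>x. x \<in> X \<Longrightarrow> w x = w' x"
  shows "rat_defined q w \<longleftrightarrow> rat_defined q w'" "rat_eval q w = rat_eval q w'"
proof -
  have *: "mpoly_eval P w = mpoly_eval P w' \<and> mpoly_eval Q w = mpoly_eval Q w'" if "(P, Q) \<in> q" for P Q
    using rational_function_polys_in[OF q that] mpoly_eval_cong[of _ X w w'] eq by blast
  show "rat_defined q w \<longleftrightarrow> rat_defined q w'"
    unfolding rat_defined_def using * by (intro bex_cong) auto
  show "rat_eval q w = rat_eval q w'"
    unfolding rat_eval_def using * by (intro arg_cong[where f = The] ext bex_cong) auto
qed

text \<open>
  Clearing denominators turns the equality of the two values into a polynomial identity in \<open>t\<close>, which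
  holds at all parameters once it holds at infinitely many. The fractions are chosen to have nonzero
  denominators at \<open>t0\<close>. Parameters at which one of these denominators vanishes do no harm, since the
  identity is multiplied by both denominators.
\<close>

lemma rat_identity_principle:
  assumes q: "q \<in> rational_functions X"
    and def1: "rat_defined q (\<lambda>x. poly (h x) t0)" and def2: "rat_defined q (\<lambda>x. poly (k x) t0)"
    and S: "infinite S"
    and eq: "\<And>t. t \<in> S \<Longrightarrow> rat_defined q (\<lambda>x. poly (h x) t) \<Longrightarrow> rat_defined q (\<lambda>x. poly (k x) t) \<Longrightarrow>
              rat_eval q (\<lambda>x. poly (h x) t) = rat_eval q (\<lambda>x. poly (k x) t)"
  shows "rat_eval q (\<lambda>x. poly (h x) t0) = rat_eval q (\<lambda>x. poly (k x) t0)"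
proof -
  obtain P Q where PQ: "(P, Q) \<in> q" "mpoly_eval Q (\<lambda>x. poly (h x) t0) \<noteq> 0"
    using def1 by (auto simp: rat_defined_def)
  obtain P' Q' where PQ': "(P', Q') \<in> q" "mpoly_eval Q' (\<lambda>x. poly (k x) t0) \<noteq> 0"
    using def2 by (auto simp: rat_defined_def)
  define p r where "p = along_curve h P" and "r = along_curve h Q"
  define p' r' where "p' = along_curve k P'" and "r' = along_curve k Q'"
  note curve = p_def r_def p'_def r'_def poly_along_curve
  have "poly ((p * r' - p' * r) * (r * r')) t = 0" if "t \<in> S" for t
  proof (cases "poly r t = 0 \<or> poly r' t = 0")
    case False
    then have ne: "mpoly_eval Q (\<lambda>x. poly (h x) t) \<noteq> 0" "mpoly_eval Q' (\<lambda>x. poly (k x) t) \<noteq> 0"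
      by (simp_all add: curve)
    then have "rat_eval q (\<lambda>x. poly (h x) t) = rat_eval q (\<lambda>x. poly (k x) t)"
      using PQ(1) PQ'(1) that by (intro eq) (auto simp: rat_defined_def)
    then show ?thesis
      using ne by (simp add: rat_eval_eq[OF q PQ(1)] rat_eval_eq[OF q PQ'(1)] curve frac_eq_eq)
  qed auto
  then have "S \<subseteq> {t. poly ((p * r' - p' * r) * (r * r')) t = 0}" by blast
  then have "infinite {t. poly ((p * r' - p' * r) * (r * r')) t = 0}"
    using S by (rule infinite_super)
  then have "(p * r' - p' * r) * (r * r') = 0" using poly_roots_finite by blast
  moreover have "poly r t0 \<noteq> 0" "poly r' t0 \<noteq> 0" using PQ(2) PQ'(2) by (simp_all add: curve)
  then have "r \<noteq> 0" "r' \<noteq> 0" by auto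
  ultimately have "p * r' = p' * r" by simp
  then have "poly (p * r') t0 = poly (p' * r) t0" by simp
  then show ?thesis
    using PQ PQ' by (simp add: rat_eval_eq[OF q PQ] rat_eval_eq[OF q PQ'] frac_eq_eq curve)
qed

section \<open>Functions of the ratios\<close>

text \<open>
  A quantity depends only on the ratios as soon as it agrees on profiles with the same ratios: \<open>F\<close>
  evaluates it at an arbitrarily chosen profile with the given ratios.
\<close>

lemma function_of_ratiosI:
  assumes "\<And>J J'. D J \<Longrightarrow> D J' \<Longrightarrow> rat_defined q (V J) \<Longrightarrow> rat_defined q (V J') \<Longrightarrow>
      (\<And>k. k \<in> listed_ratios D V K den \<Longrightarrow> den (V J) k \<noteq> 0) \<Longrightarrow>
      (\<And>k. k \<in> listed_ratios D V K den \<Longrightarrow> den (V J') k \<noteq> 0) \<Longrightarrow>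
      (\<And>k. k \<in> listed_ratios D V K den \<Longrightarrow> num (V J) k / den (V J) k = num (V J') k / den (V J') k) \<Longrightarrow>
      rat_eval q (V J) = rat_eval q (V J')"
  shows "function_of_ratios D V K num den q"
proof -
  define L where "L = listed_ratios D V K den"
  define good where "good J \<longleftrightarrow> D J \<and> rat_defined q (V J) \<and> (\<forall>k\<in>L. den (V J) k \<noteq> 0)" for J
  define R where "R J = (\<lambda>k\<in>L. num (V J) k / den (V J) k)" for J
  define F where "F r = rat_eval q (V (SOME J. good J \<and> R J = r))" for r
  have "rat_eval q (V J) = F (R J)" if "good J" for J
  proof -
    define J' where "J' = (SOME J'. good J' \<and> R J' = R J)"
    have J': "good J'" "R J' = R J"
      unfolding J'_def using someI[of "\<lambda>J'. good J' \<and> R J' = R J" J] that by auto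
    have "num (V J) k / den (V J) k = num (V J') k / den (V J') k" if "k \<in> L" for k
      using fun_cong[OF J'(2), of k] that by (simp add: R_def)
    then have "rat_eval q (V J) = rat_eval q (V J')"
      using that J'(1) by (intro assms) (auto simp: good_def L_def)
    then show ?thesis by (simp add: F_def J'_def)
  qed
  then show ?thesis
    unfolding function_of_ratios_def good_def R_def L_def by blast
qed

lemma function_of_ratiosD:
  assumes "function_of_ratios D V K num den q" "D J" "D J'" "rat_defined q (V J)" "rat_defined q (V J')"
    and "\<And>k. k \<in> listed_ratios D V K den \<Longrightarrow> den (V J) k \<noteq> 0 \<and> den (V J') k \<noteq> 0 \<and>
           num (V J) k / den (V J) k = num (V J') k / den (V J') k"
  shows "rat_eval q (V J) = rat_eval q (V J')"
proof -
  let ?L = "listed_ratios D V K den"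
  obtain F where F: "\<And>J. D J \<Longrightarrow> rat_defined q (V J) \<Longrightarrow> (\<forall>k\<in>?L. den (V J) k \<noteq> 0) \<Longrightarrow>
      rat_eval q (V J) = F (\<lambda>k\<in>?L. num (V J) k / den (V J) k)"
    using assms(1) unfolding function_of_ratios_def by blast
  have "(\<lambda>k\<in>?L. num (V J) k / den (V J) k) = (\<lambda>k\<in>?L. num (V J') k / den (V J') k)"
    using assms(6) by (intro restrict_ext) blast
  then show ?thesis using F[of J] F[of J'] assms by simp
qed

section \<open>Invariance under positive affine maps and under scalings\<close>

text \<open>
  The social cost function enters only through the families of values that occur and the maps on them
  that the transformations induce, so this covers CUC and CFC at once. Families without coinciding values
  and with the same ratios are affine images of each other. The identity principle supplies the rest:
  negative factors in one direction, coinciding values in the other.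
\<close>

lemma affine_invariant_iff_function_of_difference_ratios:
  fixes V :: "'p \<Rightarrow> 'x \<Rightarrow> real"
  assumes X: "finite X" and q: "q \<in> rational_functions X"
    and onto: "\<And>w. \<exists>J. V J = w"
    and affine: "\<And>J J'. T J J' \<Longrightarrow> \<exists>a>0. \<exists>b. V J' = (\<lambda>x. a * V J x + b)"
    and reach: "\<And>J a b. a > 0 \<Longrightarrow> \<exists>J'. T J J' \<and> V J' = (\<lambda>x. a * V J x + b)"
  shows "invariant_under (\<lambda>J. True) T V q \<longleftrightarrow> function_of_difference_ratios X (\<lambda>J. True) V q"
proof -
  have listed: "listed_ratios (\<lambda>J. True) V (X \<times> X \<times> X \<times> X) (\<lambda>w (x, y, z, u). w y - w u) =
      {(x, y, z, u) \<in> X \<times> X \<times> X \<times> X. y \<noteq> u}"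
  proof -
    have "(\<exists>J. V J y - V J u \<noteq> 0) \<longleftrightarrow> y \<noteq> u" for y u
    proof
      assume "y \<noteq> u"
      moreover obtain J where "V J = (\<lambda>x. if x = y then 1 else 0)" using onto by blast
      ultimately have "V J y - V J u \<noteq> 0" by simp
      then show "\<exists>J. V J y - V J u \<noteq> 0" ..
    qed auto
    then show ?thesis unfolding listed_ratios_def by auto
  qed
  show ?thesis
  proof
    assume inv: "invariant_under (\<lambda>J. True) T V q"
    have same: "rat_eval q (V J) = rat_eval q (V J')"
      if def: "rat_defined q (V J)" "rat_defined q (V J')"
        and sep: "\<And>y u. y \<in> X \<Longrightarrow> u \<in> X \<Longrightarrow> y \<noteq> u \<Longrightarrow> V J y \<noteq> V J u"
        and ratio: "\<And>x y z u. x \<in> X \<Longrightarrow> y \<in> X \<Longrightarrow> z \<in> X \<Longrightarrow> u \<in> X \<Longrightarrow> y \<noteq> u \<Longrightarrow>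
               (V J x - V J z) / (V J y - V J u) = (V J' x - V J' z) / (V J' y - V J' u)"
        and sep': "\<And>y u. y \<in> X \<Longrightarrow> u \<in> X \<Longrightarrow> y \<noteq> u \<Longrightarrow> V J' y \<noteq> V J' u"
      for J J'
    proof -
      \<comment> \<open>The factor \<open>a\<close> may be negative. If X has at most one element, no ratios
        are listed, and the constant map serves.\<close>
      have "\<exists>a b. \<forall>x\<in>X. V J' x = a * V J x + b"
      proof (cases "\<exists>y u. y \<in> X \<and> u \<in> X \<and> y \<noteq> u")
        case True
        then obtain y u where yu: "y \<in> X" "u \<in> X" "y \<noteq> u" by blast
        define a where "a = (V J' y - V J' u) / (V J y - V J u)"
        have "V J' x = a * V J x + (V J' u - a * V J u)" if "x \<in> X" for x
        proof -
          have cross: "(V J x - V J u) * (V J' y - V J' u) = (V J' x - V J' u) * (V J y - V J u)"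
            using ratio[OF that yu(1) yu(2) yu(2) yu(3)] sep[OF yu] sep'[OF yu]
            by (simp add: frac_eq_eq)
          have "a * (V J x - V J u) = (V J x - V J u) * (V J' y - V J' u) / (V J y - V J u)"
            by (simp add: a_def mult.commute)
          also have "\<dots> = V J' x - V J' u" unfolding cross using sep[OF yu] by simp
          finally show ?thesis by (simp add: right_diff_distrib)
        qed
        then show ?thesis by blast
      next
        case False
        show ?thesis
        proof (cases "X = {}")
          case False
          then obtain y where "y \<in> X" by blast
          with \<open>\<not> (\<exists>y u. _ y u)\<close> have "\<forall>x\<in>X. V J' x = 0 * V J x + V J' y" by auto
          then show ?thesis by blast
        qed auto
      qed
      then obtain a b where ab: "\<And>x. x \<in> X \<Longrightarrow> V J' x = a * V J x + b" by blast
      have cong: "rat_defined q (V J') = rat_defined q (\<lambda>x. b + a * V J x)"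
                 "rat_eval q (V J') = rat_eval q (\<lambda>x. b + a * V J x)"
        using rat_cong[OF q, of "V J'" "\<lambda>x. b + a * V J x"] ab by auto
      \<comment> \<open>The identity \<open>q w = q (t w + b)\<close> holds for \<open>t > 0\<close> by invariance; it is needed at \<open>t = a\<close>.\<close>
      have "rat_eval q (\<lambda>x. poly [:V J x:] a) = rat_eval q (\<lambda>x. poly [:b, V J x:] a)"
      proof (rule rat_identity_principle[OF q, where S = "{0<..}"])
        fix t :: real
        assume "t \<in> {0<..}" and d: "rat_defined q (\<lambda>x. poly [:V J x:] t)"
          "rat_defined q (\<lambda>x. poly [:b, V J x:] t)"
        then obtain J'' where J'': "T J J''" "V J'' = (\<lambda>x. t * V J x + b)"
          using reach[of t J b] by auto
        moreover have "(\<lambda>x. poly [:b, V J x:] t) = V J''" "(\<lambda>x. poly [:V J x:] t) = V J"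
          by (auto simp: J'')
        ultimately show "rat_eval q (\<lambda>x. poly [:V J x:] t) = rat_eval q (\<lambda>x. poly [:b, V J x:] t)"
          using inv d unfolding invariant_under_def by metis
      qed (use def cong in \<open>simp_all add: infinite_Ioi\<close>)
      then show ?thesis using cong by simp
    qed
    show "function_of_difference_ratios X (\<lambda>J. True) V q"
      unfolding function_of_difference_ratios_def
    proof (rule function_of_ratiosI, goal_cases)
      case (1 J J')
      show ?case
      proof (rule same)
        show "rat_defined q (V J)" "rat_defined q (V J')" by fact+
        show "V J y \<noteq> V J u" if "y \<in> X" "u \<in> X" "y \<noteq> u" for y u
          using 1(5)[of "(y, y, u, u)"] that by (simp add: listed)
        show "V J' y \<noteq> V J' u" if "y \<in> X" "u \<in> X" "y \<noteq> u" for y u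
          using 1(6)[of "(y, y, u, u)"] that by (simp add: listed)
        show "(V J x - V J z) / (V J y - V J u) = (V J' x - V J' z) / (V J' y - V J' u)"
          if "x \<in> X" "y \<in> X" "z \<in> X" "u \<in> X" "y \<noteq> u" for x y z u
          using 1(7)[of "(x, y, z, u)"] that by (simp add: listed)
      qed
    qed
  next
    assume fr: "function_of_difference_ratios X (\<lambda>J. True) V q"
    show "invariant_under (\<lambda>J. True) T V q"
      unfolding invariant_under_def
    proof (intro allI impI)
      fix J J' assume TJ: "T J J'" and def: "rat_defined q (V J)" "rat_defined q (V J')"
      obtain a b where ab: "a > 0" "V J' = (\<lambda>x. a * V J x + b)" using affine[OF TJ] by blast
      obtain f :: "'x \<Rightarrow> nat" where f: "inj_on f X"
        using finite_imp_inj_to_nat_seg[OF X] by blast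
      \<comment> \<open>An injective direction: adding \<open>t d\<close> separates the values on X for all but finitely many \<open>t\<close>.\<close>
      define d where "d x = real (f x)" for x
      have d: "d x \<noteq> d y" if "x \<in> X" "y \<in> X" "x \<noteq> y" for x y
        using f that by (auto simp: d_def inj_on_def)
      define S where "S = {t. inj_on (\<lambda>x. V J x + t * d x) X}"
      have "- S \<subseteq> (\<lambda>(x, y). (V J y - V J x) / (d x - d y)) ` (X \<times> X)"
      proof
        fix t assume "t \<in> - S"
        then obtain x y where xy: "x \<in> X" "y \<in> X" "x \<noteq> y" "V J x + t * d x = V J y + t * d y"
          by (auto simp: S_def inj_on_def)
        then have "t = (V J y - V J x) / (d x - d y)"
          using d[of x y] by (simp add: field_simps)
        then show "t \<in> (\<lambda>(x, y). (V J y - V J x) / (d x - d y)) ` (X \<times> X)" using xy by auto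
      qed
      then have "finite (- S)" using X finite_subset by blast
      then have S: "infinite S"
        by (metis finite_compl infinite_UNIV_char_0 boolean_algebra_class.boolean_algebra.double_compl)
      have "rat_eval q (\<lambda>x. poly [:V J x, d x:] 0) = rat_eval q (\<lambda>x. poly [:a * V J x + b, a * d x:] 0)"
      proof (rule rat_identity_principle[OF q _ _ S])
        fix t assume t: "t \<in> S" and def_t: "rat_defined q (\<lambda>x. poly [:V J x, d x:] t)"
          "rat_defined q (\<lambda>x. poly [:a * V J x + b, a * d x:] t)"
        obtain I where I: "V I = (\<lambda>x. poly [:V J x, d x:] t)" using onto by blast
        obtain I' where I': "V I' = (\<lambda>x. poly [:a * V J x + b, a * d x:] t)" using onto by blast
        have II': "V I' x = a * V I x + b" for x by (simp add: I I' algebra_simps)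
        have neq: "V I y \<noteq> V I u" if "y \<in> X" "u \<in> X" "y \<noteq> u" for y u
          using t that by (auto simp: S_def inj_on_def I)
        have "rat_eval q (V I) = rat_eval q (V I')"
          using fr unfolding function_of_difference_ratios_def
        proof (rule function_of_ratiosD)
          fix k assume "k \<in> listed_ratios (\<lambda>J. True) V (X \<times> X \<times> X \<times> X) (\<lambda>w (x, y, z, u). w y - w u)"
          then obtain x y z u where "k = (x, y, z, u)" "y \<in> X" "u \<in> X" "y \<noteq> u"
            by (auto simp: listed)
          then show "(case k of (x, y, z, u) \<Rightarrow> V I y - V I u) \<noteq> 0 \<and>
             (case k of (x, y, z, u) \<Rightarrow> V I' y - V I' u) \<noteq> 0 \<and>
             (case k of (x, y, z, u) \<Rightarrow> V I x - V I z) / (case k of (x, y, z, u) \<Rightarrow> V I y - V I u) =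
             (case k of (x, y, z, u) \<Rightarrow> V I' x - V I' z) / (case k of (x, y, z, u) \<Rightarrow> V I' y - V I' u)"
            using neq[of y u] ab(1) by (simp add: II' flip: right_diff_distrib)
        qed (use def_t in \<open>simp_all add: I I'\<close>)
        then show "rat_eval q (\<lambda>x. poly [:V J x, d x:] t) = rat_eval q (\<lambda>x. poly [:a * V J x + b, a * d x:] t)"
          by (simp add: I I')
      qed (use def ab in simp_all)
      then show "rat_eval q (V J) = rat_eval q (V J')" by (simp add: ab)
    qed
  qed
qed

text \<open>
  The values are nonpositive and vanish at the reference outcome. Hence the factor between two families
  with the same ratios is automatically positive, and no sign has to be recovered.
\<close>

lemma scaling_invariant_iff_function_of_value_ratios:
  fixes V :: "'p \<Rightarrow> 'x \<Rightarrow> real"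
  assumes q: "q \<in> rational_functions X"
    and onto: "\<And>w. w x0 = 0 \<Longrightarrow> (\<And>x. w x \<le> 0) \<Longrightarrow> \<exists>J. D J \<and> V J = w"
    and range: "\<And>J. D J \<Longrightarrow> V J x0 = 0 \<and> (\<forall>x. V J x \<le> 0)"
    and scaling: "\<And>J J'. D J \<Longrightarrow> T J J' \<Longrightarrow> \<exists>s>0. V J' = (\<lambda>x. s * V J x)"
    and reach: "\<And>J s. D J \<Longrightarrow> s > 0 \<Longrightarrow> \<exists>J'. T J J' \<and> V J' = (\<lambda>x. s * V J x)"
  shows "invariant_under D T V q \<longleftrightarrow> function_of_value_ratios X D V q"
proof -
  have listed: "listed_ratios D V (X \<times> X) (\<lambda>w (x, y). w y) = {(x, y) \<in> X \<times> X. y \<noteq> x0}"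
  proof -
    have "(\<exists>J. D J \<and> V J y \<noteq> 0) \<longleftrightarrow> y \<noteq> x0" for y
    proof
      assume "y \<noteq> x0"
      then have "\<exists>J. D J \<and> V J = (\<lambda>x. if x = y then -1 else 0)" by (intro onto) auto
      then obtain J where "D J" "V J = (\<lambda>x. if x = y then -1 else 0)" by blast
      then have "D J \<and> V J y \<noteq> 0" by simp
      then show "\<exists>J. D J \<and> V J y \<noteq> 0" ..
    qed (use range in auto)
    then show ?thesis unfolding listed_ratios_def by auto
  qed
  show ?thesis
  proof
    assume inv: "invariant_under D T V q"
    have same: "rat_eval q (V J) = rat_eval q (V J')"
      if D: "D J" "D J'" and def: "rat_defined q (V J)" "rat_defined q (V J')"
        and nz: "\<And>y. y \<in> X \<Longrightarrow> y \<noteq> x0 \<Longrightarrow> V J y \<noteq> 0" "\<And>y. y \<in> X \<Longrightarrow> y \<noteq> x0 \<Longrightarrow> V J' y \<noteq> 0"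
        and ratio: "\<And>x y. x \<in> X \<Longrightarrow> y \<in> X \<Longrightarrow> y \<noteq> x0 \<Longrightarrow> V J x / V J y = V J' x / V J' y"
      for J J'
    proof -
      \<comment> \<open>If X contains no outcome but the reference outcome, no ratios are listed,
        but both families are zero on X.\<close>
      have "\<exists>s>0. \<forall>x\<in>X. V J' x = s * V J x"
      proof (cases "X \<subseteq> {x0}")
        case True
        then have "\<forall>x\<in>X. V J' x = 1 * V J x" using range[OF D(1)] range[OF D(2)] by auto
        then show ?thesis using zero_less_one by blast
      next
        case False
        then obtain y where y: "y \<in> X" "y \<noteq> x0" by blast
        have neg: "V J y < 0" "V J' y < 0"
          using nz[OF y] range[OF D(1)] range[OF D(2)] by (auto simp: less_le)
        have "V J' x = V J' y / V J y * V J x" if "x \<in> X" for x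
          using ratio[OF that y] neg by (simp add: field_simps)
        then show ?thesis using neg divide_neg_neg by blast
      qed
      then obtain s where s: "s > 0" "\<And>x. x \<in> X \<Longrightarrow> V J' x = s * V J x" by blast
      obtain J'' where J'': "T J J''" "V J'' = (\<lambda>x. s * V J x)" using reach[OF D(1) s(1)] by blast
      have cong: "rat_defined q (V J') = rat_defined q (V J'')" "rat_eval q (V J') = rat_eval q (V J'')"
        using rat_cong[OF q, of "V J'" "V J''"] s by (auto simp: J'')
      then show ?thesis using inv J'' D def unfolding invariant_under_def by metis
    qed
    show "function_of_value_ratios X D V q"
      unfolding function_of_value_ratios_def
    proof (rule function_of_ratiosI, goal_cases)
      case (1 J J')
      show ?case
      proof (rule same)
        show "D J" "D J'" "rat_defined q (V J)" "rat_defined q (V J')" by fact+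
        show "V J y \<noteq> 0" if "y \<in> X" "y \<noteq> x0" for y
          using 1(5)[of "(y, y)"] that by (simp add: listed)
        show "V J' y \<noteq> 0" if "y \<in> X" "y \<noteq> x0" for y
          using 1(6)[of "(y, y)"] that by (simp add: listed)
        show "V J x / V J y = V J' x / V J' y" if "x \<in> X" "y \<in> X" "y \<noteq> x0" for x y
          using 1(7)[of "(x, y)"] that by (simp add: listed)
      qed
    qed
  next
    assume fr: "function_of_value_ratios X D V q"
    show "invariant_under D T V q"
      unfolding invariant_under_def
    proof (intro allI impI)
      fix J J' assume D: "D J" and TJ: "T J J'" and def: "rat_defined q (V J)" "rat_defined q (V J')"
      obtain s where s: "s > 0" "V J' = (\<lambda>x. s * V J x)" using scaling[OF D TJ] by blast
      \<comment> \<open>This direction stays within the admissible families for \<open>t > 0\<close>: the values away from the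
        reference outcome become negative, and the value there remains zero.\<close>
      define d :: "'x \<Rightarrow> real" where "d x = (if x = x0 then 0 else -1)" for x
      have "rat_eval q (\<lambda>x. poly [:V J x, d x:] 0) = rat_eval q (\<lambda>x. poly [:s * V J x, s * d x:] 0)"
      proof (rule rat_identity_principle[OF q, where S = "{0<..}"])
        fix t :: real
        assume "t \<in> {0<..}" and def_t: "rat_defined q (\<lambda>x. poly [:V J x, d x:] t)"
          "rat_defined q (\<lambda>x. poly [:s * V J x, s * d x:] t)"
        then have t: "t > 0" by simp
        define w where "w x = V J x + t * d x" for x
        have V0: "V J x0 = 0" and V_le: "V J x \<le> 0" for x using range[OF D] by simp_all
        have w: "w x0 = 0" "w x \<le> 0" "x \<noteq> x0 \<Longrightarrow> w x < 0" for x
          using V0 V_le[of x] t by (auto simp: w_def d_def)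
        obtain I where I: "D I" "V I = w" using onto[of w] w by blast
        obtain I' where I': "D I'" "V I' = (\<lambda>x. s * w x)"
          using onto[of "\<lambda>x. s * w x"] w s(1) by (auto simp: mult_nonneg_nonpos)
        have curve: "V I = (\<lambda>x. poly [:V J x, d x:] t)" "V I' = (\<lambda>x. poly [:s * V J x, s * d x:] t)"
          by (auto simp: I I' w_def algebra_simps)
        have "rat_eval q (V I) = rat_eval q (V I')"
          using fr unfolding function_of_value_ratios_def
        proof (rule function_of_ratiosD)
          fix k assume "k \<in> listed_ratios D V (X \<times> X) (\<lambda>w (x, y). w y)"
          then obtain x y where "k = (x, y)" "y \<noteq> x0" by (auto simp: listed)
          then show "(case k of (x, y) \<Rightarrow> V I y) \<noteq> 0 \<and> (case k of (x, y) \<Rightarrow> V I' y) \<noteq> 0 \<and>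
              (case k of (x, y) \<Rightarrow> V I x) / (case k of (x, y) \<Rightarrow> V I y) =
              (case k of (x, y) \<Rightarrow> V I' x) / (case k of (x, y) \<Rightarrow> V I' y)"
            using w(3)[of y] s(1) by (simp add: I I')
        qed (simp_all only: curve def_t I(1) I'(1))
        then show "rat_eval q (\<lambda>x. poly [:V J x, d x:] t) = rat_eval q (\<lambda>x. poly [:s * V J x, s * d x:] t)"
          by (simp add: curve)
      qed (use def s in \<open>simp_all add: infinite_Ioi\<close>)
      then show "rat_eval q (V J) = rat_eval q (V J')" by (simp add: s)
    qed
  qed
qed

section \<open>The comparability levels\<close>

lemma CUC_invariant_iff_function_of_difference_ratios:
  fixes C :: "real ^ 'n \<Rightarrow> real" and q :: "'x ratfun"
  assumes "finite X" "q \<in> rational_functions X" "CUC_admissible C"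
  defines "V \<equiv> \<lambda>J :: ('n, 'x) profile. \<lambda>x. C (costs_at J x)"
  shows "invariant_under (\<lambda>J. True) CUC_transform V q \<longleftrightarrow>
         function_of_difference_ratios X (\<lambda>J. True) V q"
proof (rule affine_invariant_iff_function_of_difference_ratios)
  obtain c where c: "\<And>i. c i > 0" and C: "\<And>v. C v = (\<Sum>i\<in>UNIV. c i * v $ i)"
    using assms(3) unfolding CUC_admissible_def by blast
  define s where "s = (\<Sum>i\<in>UNIV. c i)"
  have s: "s > 0" unfolding s_def using c by (intro sum_pos) auto
  have V: "V J x = (\<Sum>i\<in>UNIV. c i * J i x)" for J x by (simp add: V_def C costs_at_def)
  have V_affine: "V (\<lambda>i x. a * J i x + b i) x = a * V J x + (\<Sum>i\<in>UNIV. c i * b i)" for J a b x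
    by (simp add: V sum.distrib sum_distrib_left algebra_simps)
  have sum_c: "(\<Sum>i\<in>UNIV. c i * (r / s)) = r" for r
    using s by (simp add: s_def flip: sum_distrib_right sum_divide_distrib)
  \<comment> \<open>Equal costs for all agents realize any family of values, after division by the total weight.\<close>
  show "\<exists>J. V J = w" for w
    by (intro exI[of _ "\<lambda>i x. w x / s"]) (simp add: V sum_c fun_eq_iff del: times_divide_eq_right)
  show "\<exists>a>0. \<exists>b. V J' = (\<lambda>x. a * V J x + b)" if T: "CUC_transform J J'" for J J'
  proof -
    obtain a b where a: "a > 0" and J': "J' = (\<lambda>i x. a * J i x + b i)"
      using T unfolding CUC_transform_def fun_eq_iff by blast
    have "V J' = (\<lambda>x. a * V J x + (\<Sum>i\<in>UNIV. c i * b i))"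
      unfolding J' by (rule ext) (rule V_affine)
    then show ?thesis using a by blast
  qed
  show "\<exists>J'. CUC_transform J J' \<and> V J' = (\<lambda>x. a * V J x + b)" if "a > 0" for J a b
  proof (intro exI conjI)
    show "CUC_transform J (\<lambda>i x. a * J i x + b / s)"
      unfolding CUC_transform_def using that
      by (intro exI[of _ a] conjI exI[of _ "\<lambda>i. b / s"]) simp_all
    show "V (\<lambda>i x. a * J i x + b / s) = (\<lambda>x. a * V J x + b)"
      by (rule ext) (simp only: V_affine sum_c)
  qed
qed (use assms in auto)

text \<open>
  Deviations from the mean cost are unaffected by the common shift and scale with the common factor, so the
  homogeneity of \<open>g\<close> makes the social cost transform just like the individual costs. If all agents have
  the same cost, then that is the social cost, because \<open>g 0 = 0\<close>.
\<close>

lemma CFC_invariant_iff_function_of_difference_ratios: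
  fixes C :: "real ^ 'n \<Rightarrow> real" and q :: "'x ratfun"
  assumes "finite X" "q \<in> rational_functions X" "CFC_admissible C"
  defines "V \<equiv> \<lambda>J :: ('n, 'x) profile. \<lambda>x. C (costs_at J x)"
  shows "invariant_under (\<lambda>J. True) CFC_transform V q \<longleftrightarrow>
         function_of_difference_ratios X (\<lambda>J. True) V q"
proof (rule affine_invariant_iff_function_of_difference_ratios)
  obtain g where g: "\<And>t v. t > 0 \<Longrightarrow> g (t *\<^sub>R v) = t * g v"
    and C: "\<And>v. C v = mean_cost v + g (\<chi> i. v $ i - mean_cost v)"
    using assms(3) unfolding CFC_admissible_def by blast
  have V_affine: "V (\<lambda>i x. a * J i x + b) x = a * V J x + b" if "a > 0" for J a b x
  proof -
    let ?v = "costs_at J x" and ?v' = "costs_at (\<lambda>i x. a * J i x + b) x"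
    have mean: "mean_cost ?v' = a * mean_cost ?v + b"
      by (simp add: mean_cost_def costs_at_def sum.distrib field_simps flip: sum_distrib_left)
    have deviation: "(\<chi> i. ?v' $ i - mean_cost ?v') = a *\<^sub>R (\<chi> i. ?v $ i - mean_cost ?v)"
      unfolding mean by (simp add: vec_eq_iff costs_at_def algebra_simps)
    show ?thesis
      unfolding V_def C deviation unfolding mean g[OF that] by (simp add: algebra_simps)
  qed
  show "\<exists>J. V J = w" for w
  proof
    have "g 0 = 0" using g[of 2 0] by simp
    moreover have "(\<chi> i::'n. (0::real)) = 0" by (simp add: vec_eq_iff)
    moreover have "mean_cost (\<chi> i::'n. r) = r" for r by (simp add: mean_cost_def)
    ultimately show "V (\<lambda>i x. w x) = w" by (simp add: V_def C costs_at_def fun_eq_iff)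
  qed
  show "\<exists>a>0. \<exists>b. V J' = (\<lambda>x. a * V J x + b)" if T: "CFC_transform J J'" for J J'
  proof -
    obtain a b where a: "a > 0" and J': "J' = (\<lambda>i x. a * J i x + b)"
      using T unfolding CFC_transform_def fun_eq_iff by blast
    have "V J' = (\<lambda>x. a * V J x + b)"
      unfolding J' by (rule ext) (rule V_affine[OF a])
    then show ?thesis using a by blast
  qed
  show "\<exists>J'. CFC_transform J J' \<and> V J' = (\<lambda>x. a * V J x + b)" if "a > 0" for J a b
  proof (intro exI conjI)
    show "CFC_transform J (\<lambda>i x. a * J i x + b)" using that unfolding CFC_transform_def by blast
    show "V (\<lambda>i x. a * J i x + b) = (\<lambda>x. a * V J x + b)"
      by (rule ext) (rule V_affine[OF that])
  qed
qed (use assms in auto)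

text \<open>
  The shifts cancel in the differences to the reference outcome, and the individual factors combine to
  the factor \<open>\<Prod>i. a i powr c i\<close> of the social cost. Equal costs, and equal factors, for all agents already
  realize all admissible values and all positive factors, since the weighted product of equal numbers
  \<open>u\<close> is \<open>u powr s\<close> with \<open>s\<close> the sum of the weights.
\<close>

lemma CNC_invariant_iff_function_of_value_ratios:
  fixes C :: "real ^ 'n \<Rightarrow> real ^ 'n \<Rightarrow> real" and q :: "'x ratfun" and x0 :: 'x
  assumes q: "q \<in> rational_functions X" and "CNC_admissible C"
  defines "V \<equiv> \<lambda>J :: ('n, 'x) profile. \<lambda>x. C (costs_at J x) (costs_at J x0)"
  shows "invariant_under (benchmark_profile x0) CNC_transform V q \<longleftrightarrow>
         function_of_value_ratios X (benchmark_profile x0) V q"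
proof (rule scaling_invariant_iff_function_of_value_ratios[OF q, where ?x0.0 = x0])
  obtain c where c: "\<And>i. c i > 0"
    and C: "\<And>v v0. (\<forall>i. v0 $ i \<ge> v $ i) \<Longrightarrow> C v v0 = - (\<Prod>i\<in>UNIV. (v0 $ i - v $ i) powr c i)"
    using assms(2) unfolding CNC_admissible_def by blast
  define s where "s = (\<Sum>i\<in>UNIV. c i)"
  have s: "s > 0" unfolding s_def using c by (intro sum_pos) auto
  have V: "V J x = - (\<Prod>i\<in>UNIV. (J i x0 - J i x) powr c i)" if "benchmark_profile x0 J" for J x
    using that by (simp add: V_def C costs_at_def benchmark_profile_def)
  have prod_powr: "(\<Prod>i\<in>UNIV. u powr c i) = u powr s" if "u > 0" for u
    using that by (simp add: s_def powr_sum)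
  have V_scaled: "V (\<lambda>i x. a i * J i x + b i) x = (\<Prod>i\<in>UNIV. a i powr c i) * V J x"
    if J: "benchmark_profile x0 J" and a: "\<And>i. a i > 0" for J a b x
  proof -
    have "benchmark_profile x0 (\<lambda>i x. a i * J i x + b i)"
      using J a by (simp add: benchmark_profile_def less_imp_le mult_left_mono)
    moreover have "(a i * J i x0 + b i - (a i * J i x + b i)) powr c i =
        a i powr c i * (J i x0 - J i x) powr c i" for i
      using J a[of i] by (simp add: benchmark_profile_def powr_mult less_imp_le flip: right_diff_distrib)
    ultimately show ?thesis by (simp add: V[OF J] V prod.distrib)
  qed
  show "\<exists>J. benchmark_profile x0 J \<and> V J = w" if "w x0 = 0" "\<And>x. w x \<le> 0" for w
  proof (intro exI conjI)
    let ?J = "\<lambda>(i::'n) x. - ((- w x) powr (1 / s))"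
    show J: "benchmark_profile x0 ?J" using that by (simp add: benchmark_profile_def)
    have "V ?J x = w x" for x
    proof (cases "w x = 0")
      case True
      then show ?thesis using that by (simp add: V[OF J])
    next
      case False
      then have "w x < 0" using that(2)[of x] by simp
      then have "(\<Prod>i\<in>UNIV. ((- w x) powr (1 / s)) powr c i) = - w x"
        using s by (subst prod_powr) (simp_all add: powr_powr)
      then show ?thesis using V[OF J, of x] that(1) by simp
    qed
    then show "V ?J = w" by blast
  qed
  show "V J x0 = 0 \<and> (\<forall>x. V J x \<le> 0)" if "benchmark_profile x0 J" for J
    by (simp add: V[OF that] prod_nonneg)
  show "\<exists>t>0. V J' = (\<lambda>x. t * V J x)" if J: "benchmark_profile x0 J" and T: "CNC_transform J J'" for J J'
  proof -
    obtain a b where a: "\<And>i. a i > 0" and J': "J' = (\<lambda>i x. a i * J i x + b i)"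
      using T unfolding CNC_transform_def fun_eq_iff by blast
    have "(\<Prod>i\<in>UNIV. a i powr c i) > 0" using a by (intro prod_pos) (simp add: less_imp_neq[symmetric])
    moreover have "V J' = (\<lambda>x. (\<Prod>i\<in>UNIV. a i powr c i) * V J x)"
      unfolding J' by (rule ext) (rule V_scaled[OF J a])
    ultimately show ?thesis by blast
  qed
  show "\<exists>J'. CNC_transform J J' \<and> V J' = (\<lambda>x. t * V J x)"
    if J: "benchmark_profile x0 J" and t: "t > 0" for J t
  proof (intro exI conjI)
    define r where "r = t powr (1 / s)"
    have r: "r > 0" using t by (simp add: r_def)
    show "CNC_transform J (\<lambda>i x. r * J i x + 0)"
      unfolding CNC_transform_def using r
      by (intro exI[of _ "\<lambda>i. r"] exI[of _ "\<lambda>i. 0"] conjI) simp_all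
    have "(\<Prod>i\<in>UNIV. r powr c i) = t"
      unfolding prod_powr[OF r] using t s by (simp add: r_def powr_powr)
    moreover have "V (\<lambda>i x. r * J i x + 0) x = (\<Prod>i\<in>UNIV. r powr c i) * V J x" for x
      by (rule V_scaled[OF J r])
    ultimately show "V (\<lambda>i x. r * J i x + 0) = (\<lambda>x. t * V J x)" by (intro ext) (simp only:)
  qed
qed

theorem proposition2:
  fixes X' :: "'x set" and q :: "'x ratfun"
  assumes "finite X'"
    and "q \<in> rational_functions X'"
  shows
    "(\<forall>C :: real ^ 'n \<Rightarrow> real. CUC_admissible C \<longrightarrow>
        (let V = (\<lambda>J :: ('n, 'x) profile. \<lambda>x. C (costs_at J x)) in
           invariant_under (\<lambda>J. True) CUC_transform V q
             \<longleftrightarrow> function_of_difference_ratios X' (\<lambda>J. True) V q)) \<and>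
     (\<forall>C :: real ^ 'n \<Rightarrow> real. CFC_admissible C \<longrightarrow>
        (let V = (\<lambda>J :: ('n, 'x) profile. \<lambda>x. C (costs_at J x)) in
           invariant_under (\<lambda>J. True) CFC_transform V q
             \<longleftrightarrow> function_of_difference_ratios X' (\<lambda>J. True) V q)) \<and>
     (\<forall>(x0 :: 'x) (C :: real ^ 'n \<Rightarrow> real ^ 'n \<Rightarrow> real). CNC_admissible C \<longrightarrow>
        (let V = (\<lambda>J :: ('n, 'x) profile. \<lambda>x. C (costs_at J x) (costs_at J x0)) in
           invariant_under (benchmark_profile x0) CNC_transform V q
             \<longleftrightarrow> function_of_value_ratios X' (benchmark_profile x0) V q))"
  unfolding Let_def
  using CUC_invariant_iff_function_of_difference_ratios[OF assms]
    CFC_invariant_iff_function_of_difference_ratios[OF assms]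
    CNC_invariant_iff_function_of_value_ratios[OF assms(2)]
  by blast

end
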